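(* Let $h:\mathbb R_+\to\mathbb R$ be a continuous increasing function with $h(0)\le0$ satisfying $$\lim_{t\to\infty}\frac{h(t)}t=\infty\quad\text{and}\quad\limsup_{t\to\infty}\frac{h(t+1)}{h(t)}<\infty.$$ Let $f(z):=\sum_{j=0}^\infty c_jz^j$ be a holomorphic function in a neighbourhood of $0\in\mathbb C$ such that $$\ln|c_j|=-\int_0^jh^{-1}(s)\,ds,\qquad j\in\mathbb Z_+.$$ Then $f$ is an entire function of finite order of class $\mathscr C$ satisfying $\lim_{t\to\infty}\frac{\phi_f(t)}{t^2}=\infty$. Moreover, $$\rho_f=\limsup_{t\to\infty}\frac{\ln h(t)}t.$$
   Context: $\mathbb R_+=[0,\infty)$, $\mathbb Z_+=\{0,1,2,\dots\}$. "Increasing" means strictly increasing, and $h^{-1}:[h(0),\infty)\to[0,\infty)$ is the inverse function of $h$. For an entire function $f$ on $\mathbb C^n$: $M_f(r):=\sup_{\|z\|<r}|f(z)|$ ($\|\cdot\|$ the Euclidean norm), $m_f(r):=\ln M_f(r)$, the order is $\rho_f:=\limsup_{r\to\infty}\frac{\ln m_f(r)}{\ln r}$ ($f$ is of finite order if $\rho_f<\infty$), and $\phi_f(t):=m_f(e^t)$, $t\in\mathbb R$. Class $\mathscr C$ consists of the nonpolynomial entire functions $f$ satisfying one of the following: (I) $\rho_f<\infty$ and $\limsup_{t\to\infty}\frac{\phi_f(t+1)-\phi_f(t)}{\phi_f(t)-\phi_f(t-1)}<\infty$; (II) $\rho_f=\infty$ and $\lim_{t\to\infty}t^2\left(\frac1{\ln\psi(t)}\right)'=0$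 (limit over the points where $\psi'$ exists) for some convex increasing $\psi\in C(\mathbb R)$ with $\lim_{t\to\infty}\frac{\ln\psi(t)}{\ln\phi_f(t)}=1$. *)

theory Defs
  imports "HOL-Analysis.Analysis" "HOL-Computational_Algebra.Polynomial"
begin

text \<open>
  Growth notions for entire functions of one complex variable. The real-valued supremum and
  logarithms carry their intended meaning for non-polynomial entire \<open>f\<close>: then \<open>max_modulus f r\<close>
  is positive and finite for \<open>r > 0\<close>, and \<open>log_max_modulus f r\<close> tends to infinity with \<open>r\<close>.
\<close>

definition max_modulus :: "(complex \<Rightarrow> complex) \<Rightarrow> real \<Rightarrow> real" where
  "max_modulus f r = (SUP z\<in>ball 0 r. norm (f z))"

definition log_max_modulus :: "(complex \<Rightarrow> complex) \<Rightarrow> real \<Rightarrow> real" where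
  "log_max_modulus f r = ln (max_modulus f r)"

definition growth_order :: "(complex \<Rightarrow> complex) \<Rightarrow> ereal" where
  "growth_order f = Limsup at_top (\<lambda>r. ereal (ln (log_max_modulus f r) / ln r))"

definition finite_order :: "(complex \<Rightarrow> complex) \<Rightarrow> bool" where
  "finite_order f \<longleftrightarrow> growth_order f < \<infinity>"

definition phi :: "(complex \<Rightarrow> complex) \<Rightarrow> real \<Rightarrow> real" where
  "phi f t = log_max_modulus f (exp t)"

definition entire :: "(complex \<Rightarrow> complex) \<Rightarrow> bool" where
  "entire f \<longleftrightarrow> f holomorphic_on UNIV"

definition polynomial_function_complex :: "(complex \<Rightarrow> complex) \<Rightarrow> bool" where
  "polynomial_function_complex f \<longleftrightarrow> (\<exists>p. \<forall>z. f z = poly p z)"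

definition class_C_I :: "(complex \<Rightarrow> complex) \<Rightarrow> bool" where
  "class_C_I f \<longleftrightarrow> finite_order f \<and>
     Limsup at_top (\<lambda>t. ereal ((phi f (t + 1) - phi f t) / (phi f t - phi f (t - 1)))) < \<infinity>"

text \<open>
  A convex \<open>\<psi>\<close> need not be differentiable everywhere; the limit of \<open>t\<^sup>2 (1 / ln \<psi>(t))'\<close> is
  taken along the points at which \<open>\<psi>\<close> has a derivative.
\<close>

definition class_C_II :: "(complex \<Rightarrow> complex) \<Rightarrow> bool" where
  "class_C_II f \<longleftrightarrow> growth_order f = \<infinity> \<and>
     (\<exists>\<psi> :: real \<Rightarrow> real.
        continuous_on UNIV \<psi> \<and> convex_on UNIV \<psi> \<and> strict_mono \<psi> \<and>
        ((\<lambda>t. ln (\<psi> t) / ln (phi f t)) \<longlongrightarrow> 1) at_top \<and>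
        ((\<lambda>t. t\<^sup>2 * deriv (\<lambda>s. 1 / ln (\<psi> s)) t) \<longlongrightarrow> 0)
          (inf at_top (principal {t. \<psi> differentiable at t})))"

definition class_C :: "(complex \<Rightarrow> complex) set" where
  "class_C = {f. entire f \<and> \<not> polynomial_function_complex f \<and> (class_C_I f \<or> class_C_II f)}"

end

theory Submission
  imports Defs "HOL-Complex_Analysis.Complex_Analysis" "HOL-Real_Asymp.Real_Asymp"
begin

text \<open>
  Let \<open>G\<close> be the convex primitive of \<open>h\<inverse>\<close> and \<open>H\<close> its Legendre transform, so that
  \<open>|c\<^sub>j| e\<^bsup>jt\<^esup> = e\<^bsup>jt - G(j)\<^esup> \<le> e\<^bsup>H(t)\<^esup>\<close>, with equality up to a factor \<open>e\<^sup>t\<close> at \<open>j = \<lfloor>h(t)\<rfloor>\<close>. Cauchy's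
  estimate bounds \<open>\<phi>\<^sub>f\<close> from below by \<open>H(t) - t\<close>. Comparing with the terms at \<open>t + 1\<close>, all but
  about \<open>h(t + 1)\<close> terms of the series are dominated by \<open>e\<^bsup>H(t)\<^esup>\<close> times a geometric series, hence
  \<open>\<phi>\<^sub>f(t) \<le> H(t) + ln (h(t + 1) + 3)\<close>. The doubling condition makes \<open>h\<close> at most exponential, so
  \<open>\<phi>\<^sub>f(t) = H(t) + O(t)\<close>. Since \<open>h(s)(t - s) \<le> H(t) - H(s) \<le> h(t)(t - s)\<close> and \<open>h(t)/t \<rightarrow> \<infinity>\<close>, the
  error is negligible even in the increments of \<open>\<phi>\<^sub>f\<close>.
\<close>

section \<open>Limits superior and the order in logarithmic scale\<close>

lemma Limsup_ereal_le_of_diff_tendsto_0: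
  fixes u v :: "'a \<Rightarrow> real"
  assumes "((\<lambda>x. u x - v x) \<longlongrightarrow> 0) F"
  shows "Limsup F (\<lambda>x. ereal (u x)) \<le> Limsup F (\<lambda>x. ereal (v x))"
  unfolding Limsup_le_iff
proof (intro allI impI)
  fix y assume y: "Limsup F (\<lambda>x. ereal (v x)) < y"
  \<comment> \<open>For finite \<open>y\<close> the level \<open>z\<close> is finite too, and the
    gap between them absorbs the vanishing difference \<open>u x - v x\<close>.\<close>
  then obtain z where z: "Limsup F (\<lambda>x. ereal (v x)) < z" "z < y"
    using dense by blast
  have ev: "eventually (\<lambda>x. ereal (v x) < z) F"
    using z(1) by (rule Limsup_lessD)
  show "eventually (\<lambda>x. ereal (u x) < y) F"
  proof (cases y)
    case (real y')
    with z obtain z' where z': "z = ereal z'"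
      by (cases z) auto
    have "eventually (\<lambda>x. u x - v x < y' - z') F"
      using order_tendstoD(2)[OF assms, of "y' - z'"] z z' real by simp
    with ev show ?thesis
      by eventually_elim (use z' real in auto)
  qed (use z in auto)
qed

lemma Limsup_ereal_eq_of_diff_tendsto_0:
  fixes u v :: "'a \<Rightarrow> real"
  assumes "((\<lambda>x. u x - v x) \<longlongrightarrow> 0) F"
  shows "Limsup F (\<lambda>x. ereal (u x)) = Limsup F (\<lambda>x. ereal (v x))"
  using Limsup_ereal_le_of_diff_tendsto_0[OF assms]
    Limsup_ereal_le_of_diff_tendsto_0[of v u] tendsto_minus[OF assms]
  by (intro antisym) auto

text \<open>Substitute \<open>r = exp t\<close>, which maps the filter \<open>at_top\<close> onto
  itself.\<close>

lemma growth_order_eq_Limsup_phi: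
  "growth_order f = Limsup at_top (\<lambda>t. ereal (ln (phi f t) / t))"
proof -
  have "growth_order f =
      Limsup (filtermap exp at_top) (\<lambda>r. ereal (ln (log_max_modulus f r) / ln r))"
    by (simp add: growth_order_def filtermap_exp_at_top)
  also have "\<dots> = Limsup at_top (\<lambda>t. ereal (ln (phi f t) / t))"
    by (subst Limsup_filtermap_eq) (auto simp: phi_def inj_on_def)
  finally show ?thesis .
qed

lemma exp_minus_nat: "exp (- real j) = exp (- 1) ^ j"
  by (metis exp_of_nat_mult mult.commute mult_minus1)

lemma summable_exp_minus: "summable (\<lambda>j. exp (- real j))"
  unfolding exp_minus_nat by (rule summable_geometric) simp

lemma suminf_exp_minus_le: "(\<Sum>j. exp (- real j)) \<le> 2"
proof -
  have "exp (- 1 :: real) \<le> 1 / 2"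
    using exp_ge_add_one_self[of "1 :: real"] by (simp add: exp_minus field_simps)
  thus ?thesis
    unfolding exp_minus_nat by (subst suminf_geometric) (auto simp: field_simps)
qed

section \<open>Entire functions given by their Taylor series at 0\<close>

locale everywhere_convergent =
  fixes c :: "nat \<Rightarrow> complex" and f :: "complex \<Rightarrow> complex"
  assumes sums: "(\<lambda>j. c j * z ^ j) sums f z"
begin

lemma conv_radius_eq: "conv_radius c = \<infinity>"
proof -
  have "conv_radius c \<ge> ereal r" for r
    by (rule conv_radius_geI_ex') (use sums sums_summable in blast)
  thus ?thesis
    by (metis ereal_top)
qed

lemma eval_fps_eq: "eval_fps (Abs_fps c) = f"
  using sums by (auto simp: eval_fps_def fun_eq_iff sums_iff)

lemma holomorphic: "f holomorphic_on A"
  using holomorphic_on_eval_fps[of A "Abs_fps c"] 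
  by (simp add: eval_fps_eq fps_conv_radius_def conv_radius_eq)

lemma coeff_eq_deriv: "c n = (deriv ^^ n) f 0 / fact n"
  using fps_nth_conv_deriv[of "Abs_fps c" n]
  by (simp add: eval_fps_eq fps_conv_radius_def conv_radius_eq)

text \<open>Taylor coefficients are unique, so those of a polynomial would have to agree with
  \<open>c\<close>, yet they vanish beyond its degree.\<close>

lemma not_polynomial:
  assumes "\<And>j. c j \<noteq> 0"
  shows "\<not> polynomial_function_complex f"
proof
  assume "polynomial_function_complex f"
  then obtain p where "f = poly p"
    by (auto simp: polynomial_function_complex_def)
  hence "f = eval_fps (fps_of_poly p)"
    by (simp add: fun_eq_iff)
  hence "coeff p n = c n" for n
    using fps_nth_conv_deriv[of "fps_of_poly p" n] coeff_eq_deriv[of n] by simp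
  thus False
    using assms[of "Suc (degree p)"] coeff_eq_0[of p "Suc (degree p)"] by simp
qed

lemma bdd_above_ball: "bdd_above ((\<lambda>z. norm (f z)) ` ball 0 r)"
proof -
  have "continuous_on (cball 0 r) (\<lambda>z. norm (f z))"
    using holomorphic holomorphic_on_imp_continuous_on continuous_on_norm by blast
  hence "bdd_above ((\<lambda>z. norm (f z)) ` cball 0 r)"
    by (intro bounded_imp_bdd_above compact_imp_bounded compact_continuous_image) auto
  thus ?thesis
    by (rule bdd_above_mono) auto
qed

lemma Cauchy_le_max_modulus:
  assumes r: "0 < r"
  shows "norm (c n) * r ^ n \<le> max_modulus f r"
proof -
  have cont: "continuous_on A f" for A
    using holomorphic holomorphic_on_imp_continuous_on by blast
  have "norm ((deriv ^^ n) f 0) \<le> fact n * max_modulus f r / r ^ n"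
  proof (rule Cauchy_inequality)
    fix x :: complex assume "norm (0 - x) = r"
    \<comment> \<open>\<open>max_modulus\<close> is a supremum over the open ball, whereas Cauchy's
      inequality asks for a bound on the circle; continuity carries the bound over to the
      closure.\<close>
    hence x: "x \<in> closure (ball 0 r)"
      using r by simp
    show "norm (f x) \<le> max_modulus f r"
    proof (rule continuous_on_closure_norm_le[OF cont _ x])
      show "\<forall>y\<in>ball 0 r. norm (f y) \<le> max_modulus f r"
        unfolding max_modulus_def using bdd_above_ball by (auto intro!: cSUP_upper)
    qed
  qed (use r cont holomorphic in auto)
  thus ?thesis
    using r by (simp add: coeff_eq_deriv norm_divide field_simps)
qed

end

section \<open>The profile \<open>h\<close>, its inverse and the Legendre transform\<close>

locale growth_profile =
  fixes h :: "real \<Rightarrow> real"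
  assumes cont: "continuous_on {0..} h"
    and mono: "strict_mono_on {0..} h"
    and h_0: "h 0 \<le> 0"
    and superlinear: "filterlim (\<lambda>t. h t / t) at_top at_top"
    and doubling: "Limsup at_top (\<lambda>t. ereal (h (t + 1) / h t)) < \<infinity>"
begin

definition g :: "real \<Rightarrow> real" where
  "g = inv_into {0..} h"

definition G :: "real \<Rightarrow> real" where
  "G x = integral {0..x} g"

text \<open>For \<open>h t \<ge> 0\<close> this is the Legendre transform of \<open>G\<close> at \<open>t\<close>, attained at \<open>h t\<close>.\<close>

definition H :: "real \<Rightarrow> real" where
  "H t = t * h t - G (h t)"

lemma h_mono: "0 \<le> s \<Longrightarrow> s \<le> t \<Longrightarrow> h s \<le> h t"
  using mono by (auto simp: strict_mono_on_def order_le_less)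

lemma eventually_h_ge: "eventually (\<lambda>t. h t \<ge> A * t) at_top"
proof -
  have "eventually (\<lambda>t. h t / t \<ge> A) at_top"
    using superlinear by (simp add: filterlim_at_top)
  thus ?thesis
    using eventually_gt_at_top[of 0] by eventually_elim (simp add: field_simps)
qed

lemma eventually_h_pos: "eventually (\<lambda>t. h t > 0) at_top"
  using eventually_h_ge[of 1] eventually_gt_at_top[of 0] by eventually_elim auto

text \<open>Intermediate values between \<open>h 0 \<le> 0\<close> and the unbounded growth of
  \<open>h\<close>. This makes \<open>g\<close> a genuine right inverse of \<open>h\<close> on the
  nonnegative half-line, the range over which \<open>G\<close> integrates it.\<close>

lemma h_surj:
  assumes "0 \<le> y"
  obtains t where "t \<ge> 0" "h t = y"
proof -
  have "eventually (\<lambda>t. h t \<ge> y \<and> t \<ge> 0) at_top"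
    using eventually_h_ge[of 1] eventually_ge_at_top[of "max 0 y"] by eventually_elim auto
  then obtain b where "h b \<ge> y" "b \<ge> 0"
    using eventually_happens trivial_limit_at_top_linorder by blast
  moreover have "continuous_on {0..b} h"
    using cont by (rule continuous_on_subset) auto
  ultimately have "\<exists>t\<ge>0. t \<le> b \<and> h t = y"
    using h_0 assms by (intro IVT') auto
  thus ?thesis
    using that by blast
qed

lemma h_g: "0 \<le> y \<Longrightarrow> h (g y) = y" and g_nonneg: "0 \<le> y \<Longrightarrow> 0 \<le> g y"
proof -
  assume "0 \<le> y"
  hence y: "y \<in> h ` {0..}"
    by (metis h_surj atLeast_iff imageI)
  show "h (g y) = y"
    using y by (simp add: g_def f_inv_into_f)
  show "0 \<le> g y"
    using inv_into_into[OF y] by (simp add: g_def)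
qed

lemma g_h: "0 \<le> t \<Longrightarrow> g (h t) = t"
  unfolding g_def using mono strict_mono_on_imp_inj_on by (auto intro: inv_into_f_f)

lemma g_mono: "0 \<le> x \<Longrightarrow> x \<le> y \<Longrightarrow> g x \<le> g y"
proof (rule ccontr)
  assume *: "0 \<le> x" "x \<le> y" "\<not> g x \<le> g y"
  hence "h (g y) < h (g x)"
    using mono g_nonneg[of x] g_nonneg[of y] by (auto simp: strict_mono_on_def)
  with * show False
    using h_g[of x] h_g[of y] by auto
qed

lemma g_integrable: "0 \<le> x \<Longrightarrow> g integrable_on {x..y}"
  by (rule integrable_on_mono_on) (auto simp: mono_on_def intro: g_mono)

lemma G_diff:
  assumes "0 \<le> x" "x \<le> y"
  shows "G y - G x = integral {x..y} g"
  unfolding G_def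
  using Henstock_Kurzweil_Integration.integral_combine[OF assms g_integrable] by simp

lemma G_diff_le:
  assumes "0 \<le> x" "x \<le> y"
  shows "G y - G x \<le> g y * (y - x)"
proof -
  have "integral {x..y} g \<le> integral {x..y} (\<lambda>_. g y)"
    using assms by (intro integral_le g_integrable) (auto intro: g_mono)
  thus ?thesis
    using assms by (simp add: G_diff algebra_simps)
qed

lemma G_diff_ge:
  assumes "0 \<le> x" "x \<le> y"
  shows "G y - G x \<ge> g x * (y - x)"
proof -
  have "integral {x..y} (\<lambda>_. g x) \<le> integral {x..y} g"
    using assms by (intro integral_le g_integrable) (auto intro: g_mono)
  thus ?thesis
    using assms by (simp add: G_diff algebra_simps)
qed

lemma G_0 [simp]: "G 0 = 0"
  by (simp add: G_def)

lemma G_nonneg: "0 \<le> x \<Longrightarrow> 0 \<le> G x"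
  by (rule order_trans[OF _ G_diff_ge[of 0 x, simplified]])
    (auto intro: mult_nonneg_nonneg g_nonneg)

text \<open>The slope \<open>g\<close> of \<open>G\<close> is at most \<open>t\<close> to the left
  of \<open>h t\<close> and at least \<open>t\<close> to the right, so \<open>x * t - G x\<close> is
  largest at \<open>x = h t\<close>.\<close>

lemma Young_le_H:
  assumes "0 \<le> x" "0 \<le> t" "0 \<le> h t"
  shows "x * t - G x \<le> H t"
proof (cases "x \<le> h t")
  case True
  thus ?thesis
    using G_diff_le[OF assms(1) True] assms by (simp add: H_def g_h algebra_simps)
next
  case False
  thus ?thesis
    using G_diff_ge[OF assms(3), of x] assms by (simp add: H_def g_h algebra_simps)
qed

lemma H_nonneg: "0 \<le> t \<Longrightarrow> 0 \<le> h t \<Longrightarrow> 0 \<le> H t"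
  using Young_le_H[of 0 t] by simp

lemma H_le: "0 \<le> h t \<Longrightarrow> H t \<le> t * h t"
  using G_nonneg[of "h t"] by (simp add: H_def)

text \<open>Young's inequality at \<open>t\<close>, tested at the maximizer \<open>h s\<close> that
  belongs to \<open>s\<close>. The order of \<open>s\<close> and \<open>t\<close> is left open, so
  exchanging them yields the upper bound \<open>h t * (t - s)\<close> for the same
  difference.\<close>

lemma H_diff_ge:
  assumes "0 \<le> s" "0 \<le> t" "0 \<le> h s" "0 \<le> h t"
  shows "h s * (t - s) \<le> H t - H s"
  using Young_le_H[of "h s" t] assms by (simp add: H_def algebra_simps)

text \<open>Rounding the maximizer \<open>h t\<close> down costs at most \<open>t\<close> in the
  linear part, while \<open>G\<close> can only become smaller.\<close>

lemma H_le_integer_term: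
  assumes "0 \<le> t" "0 \<le> h t"
  obtains j :: nat where "H t - t \<le> real j * t - G (real j)"
proof
  define j where "j = nat \<lfloor>h t\<rfloor>"
  have j: "real j \<le> h t" "h t \<le> real j + 1"
    using assms by (simp_all add: j_def)
  have "0 \<le> g (real j) * (h t - real j)"
    using j by (intro mult_nonneg_nonneg g_nonneg) auto
  hence "G (real j) \<le> G (h t)"
    using G_diff_ge[OF _ j(1)] by simp
  moreover have "h t * t \<le> (real j + 1) * t"
    using j assms by (intro mult_right_mono) auto
  ultimately show "H t - t \<le> real j * t - G (real j)"
    by (simp add: H_def algebra_simps)
qed

lemma eventually_doubling:
  obtains K where "K \<ge> 1" "eventually (\<lambda>t. h (t + 1) \<le> K * h t) at_top"
proof -
  obtain K where K: "Limsup at_top (\<lambda>t. ereal (h (t + 1) / h t)) < ereal K"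
    using doubling less_PInf_Ex_of_nat by force
  have "eventually (\<lambda>t. h (t + 1) \<le> max 1 K * h t) at_top"
    using Limsup_lessD[OF K] eventually_h_pos
  proof eventually_elim
    case (elim t)
    hence "h (t + 1) \<le> K * h t"
      by (simp add: field_simps)
    also have "\<dots> \<le> max 1 K * h t"
      using elim by (intro mult_right_mono) auto
    finally show ?case .
  qed
  thus ?thesis
    using that[of "max 1 K"] by simp
qed

text \<open>Each unit step multiplies \<open>h\<close> by at most \<open>K\<close>, so
  \<open>h\<close> grows at most like \<open>K ^ n\<close> over \<open>n\<close> steps.\<close>

lemma h_exponential_bound:
  obtains B where "B \<ge> 1" "eventually (\<lambda>t. h t \<le> exp (B * t)) at_top"
proof -
  obtain K where K: "K \<ge> 1" "eventually (\<lambda>t. h (t + 1) \<le> K * h t) at_top"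
    by (rule eventually_doubling)
  have "eventually (\<lambda>t. h (t + 1) \<le> K * h t \<and> 0 < h t \<and> 0 \<le> t) at_top"
    using K(2) eventually_h_pos eventually_ge_at_top[of 0] by eventually_elim auto
  then obtain T where T: "\<And>t. t \<ge> T \<Longrightarrow> h (t + 1) \<le> K * h t \<and> 0 < h t \<and> 0 \<le> t"
    by (auto simp: eventually_at_top_linorder)
  have iter: "h (T + 1 + real n) \<le> K ^ n * h (T + 1)" for n
  proof (induction n)
    case (Suc n)
    have "h (T + 1 + real (Suc n)) \<le> K * h (T + 1 + real n)"
      using T[of "T + 1 + real n"] by (simp add: algebra_simps)
    also have "\<dots> \<le> K * (K ^ n * h (T + 1))"
      using Suc.IH K(1) by (intro mult_left_mono) auto
    finally show ?case by simp
  qed simp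
  \<comment> \<open>The rate \<open>ln K\<close> comes from the iteration; the extra 1 pays for the
    initial value \<open>h (T + 1)\<close>, eventually below \<open>exp t\<close>.\<close>
  define B where "B = 1 + ln K"
  have "eventually (\<lambda>t. exp t \<ge> h (T + 1)) at_top"
    using exp_at_top by (simp add: filterlim_at_top)
  hence "eventually (\<lambda>t. h t \<le> exp (B * t)) at_top"
    using eventually_ge_at_top[of "T + 1"]
  proof eventually_elim
    case (elim t)
    \<comment> \<open>The number of unit steps from \<open>T + 1\<close> needed to reach
      \<open>t\<close>. Starting at \<open>T + 1\<close> instead of \<open>T\<close> compensates for
      rounding up and gives \<open>real n \<le> t\<close>, as \<open>T\<close> is
      nonnegative.\<close>
    define n where "n = nat \<lceil>t - (T + 1)\<rceil>"
    have n: "t \<le> T + 1 + real n" "real n \<le> t"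
      using elim T[of T] by (auto simp: n_def) linarith+
    have "h t \<le> h (T + 1 + real n)"
      using n elim T[of T] by (intro h_mono) auto
    also have "\<dots> \<le> K ^ n * h (T + 1)"
      by (rule iter)
    also have "K ^ n = exp (ln K * real n)"
      using K(1) by (simp add: exp_of_nat2_mult)
    also have "exp (ln K * real n) * h (T + 1) \<le> exp (ln K * t) * exp t"
      using elim n K(1) T[of "T + 1"] by (intro mult_mono) (auto intro: mult_left_mono)
    also have "\<dots> = exp (B * t)"
      by (simp add: B_def algebra_simps flip: exp_add)
    finally show ?case .
  qed
  thus ?thesis
    using that[of B] K(1) by (simp add: B_def)
qed

end

section \<open>Convergence and size of the series\<close>

locale growth_series = growth_profile h for h +
  fixes c :: "nat \<Rightarrow> complex" and f :: "complex \<Rightarrow> complex"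
  assumes norm_c: "norm (c j) = exp (- G (real j))"
    and f_eq: "f z = (\<Sum>j. c j * z ^ j)"
begin

text \<open>Young's inequality at level \<open>s\<close> estimates a term on the circle of radius
  \<open>exp t\<close>. The choice \<open>s = t\<close> gives a bound uniform in \<open>j\<close>,
  and \<open>s = t + 1\<close> gives geometric decay.\<close>

lemma term_le:
  assumes "norm z \<le> exp t" "0 \<le> s" "0 \<le> h s"
  shows "norm (c j * z ^ j) \<le> exp (H s - real j * (s - t))"
proof -
  have "norm (c j * z ^ j) \<le> exp (- G (real j)) * exp t ^ j"
    using assms(1) by (auto simp: norm_mult norm_power norm_c intro!: mult_left_mono power_mono)
  also have "\<dots> = exp (real j * t - G (real j))"
    by (simp add: exp_of_nat_mult[symmetric] flip: exp_add)
  also have "\<dots> \<le> exp (H s - real j * (s - t))"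
    using Young_le_H[of "real j" s] assms by (simp add: algebra_simps)
  finally show ?thesis .
qed

lemma summable_norm_terms: "summable (\<lambda>j. norm (c j * z ^ j))"
proof -
  have "eventually (\<lambda>t. norm z \<le> exp t \<and> t \<ge> 0 \<and> 0 < h (t + 1)) at_top"
  proof (intro eventually_conj)
    show "eventually (\<lambda>t. norm z \<le> exp t) at_top"
      using exp_at_top by (simp add: filterlim_at_top)
    show "eventually (\<lambda>t. 0 < h (t + 1)) at_top"
      by (rule eventually_compose_filterlim[OF eventually_h_pos]) real_asymp
  qed (rule eventually_ge_at_top)
  then obtain t where t: "norm z \<le> exp t" "t \<ge> 0" "0 < h (t + 1)"
    using eventually_happens trivial_limit_at_top_linorder by blast
  show ?thesis
  proof (rule summable_comparison_test')
    show "summable (\<lambda>j. exp (H (t + 1)) * exp (- real j))"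
      by (intro summable_mult summable_exp_minus)
    show "norm (norm (c j * z ^ j)) \<le> exp (H (t + 1)) * exp (- real j)" if "j \<ge> 0" for j
      using term_le[OF t(1), of "t + 1" j] t by (simp flip: exp_add)
  qed
qed

sublocale everywhere_convergent c f
  by unfold_locales
    (unfold f_eq, rule summable_sums[OF summable_norm_cancel[OF summable_norm_terms]])

lemma norm_f_le:
  assumes z: "norm z \<le> exp t" and t: "0 \<le> t" "0 \<le> h t"
  shows "norm (f z) \<le> (h (t + 1) + 3) * exp (H t)"
proof -
  have h1: "0 \<le> h (t + 1)"
    using h_mono[of t "t + 1"] t by simp
  \<comment> \<open>From index \<open>N\<close> on, the decay \<open>exp (- real N)\<close>
    outweighs the growth \<open>H (t + 1) - H t \<le> h (t + 1)\<close>. The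
    \<open>N \<le> h (t + 1) + 1\<close> earlier terms and the tail, at most 2 in units of
    \<open>exp (H t)\<close>, add up to the factor \<open>h (t + 1) + 3\<close>.\<close>
  define N where "N = nat \<lceil>h (t + 1)\<rceil>"
  have N: "h (t + 1) \<le> real N" "real N \<le> h (t + 1) + 1"
    using h1 by (simp_all add: N_def)
  let ?a = "\<lambda>j. norm (c j * z ^ j)"
  have tail: "?a (j + N) \<le> exp (H t) * exp (- real j)" for j
  proof -
    have "?a (j + N) \<le> exp (H (t + 1) - real (j + N) * ((t + 1) - t))"
      using t h1 by (intro term_le z) auto
    also have "\<dots> \<le> exp (H t + - real j)"
      using H_diff_ge[of "t + 1" t] t h1 N by simp
    finally show ?thesis
      by (simp only: exp_add)
  qed
  have "norm (f z) \<le> (\<Sum>j. ?a j)"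
    unfolding f_eq by (rule summable_norm[OF summable_norm_terms])
  also have "\<dots> = (\<Sum>j. ?a (j + N)) + (\<Sum>j<N. ?a j)"
    by (rule suminf_split_initial_segment[OF summable_norm_terms])
  also have "(\<Sum>j. ?a (j + N)) \<le> (\<Sum>j. exp (H t) * exp (- real j))"
    by (intro suminf_le tail summable_mult summable_exp_minus
        summable_ignore_initial_segment[OF summable_norm_terms])
  also have "\<dots> \<le> exp (H t) * 2"
    by (subst suminf_mult[OF summable_exp_minus])
      (intro mult_left_mono suminf_exp_minus_le, simp)
  also have "(\<Sum>j<N. ?a j) \<le> (\<Sum>j<N. exp (H t))"
    using term_le[OF z t] by (intro sum_mono) simp
  also have "(\<Sum>j<N. exp (H t)) = real N * exp (H t)"
    by simp
  also have "exp (H t) * 2 + real N * exp (H t) = (real N + 2) * exp (H t)"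
    by (simp add: algebra_simps)
  also have "\<dots> \<le> (h (t + 1) + 3) * exp (H t)"
    using N by (intro mult_right_mono) auto
  finally show ?thesis by simp
qed

section \<open>Comparison of \<open>phi\<close> with the Legendre transform\<close>

lemma phi_le:
  assumes "0 \<le> t" "0 \<le> h t"
  shows "phi f t \<le> H t + ln (h (t + 1) + 3)"
proof -
  have h1: "0 \<le> h (t + 1)"
    using h_mono[of t "t + 1"] assms by simp
  have "max_modulus f (exp t) \<le> (h (t + 1) + 3) * exp (H t)"
    unfolding max_modulus_def using assms norm_f_le by (intro cSUP_least) auto
  moreover have "0 < max_modulus f (exp t)"
    using Cauchy_le_max_modulus[of "exp t" 0] norm_c[of 0] by simp
  ultimately have "phi f t \<le> ln ((h (t + 1) + 3) * exp (H t))"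
    by (simp add: phi_def log_max_modulus_def)
  thus ?thesis
    using h1 by (simp add: ln_mult)
qed

lemma phi_ge:
  assumes "0 \<le> t" "0 \<le> h t"
  shows "H t - t \<le> phi f t"
proof -
  obtain j :: nat where j: "H t - t \<le> real j * t - G (real j)"
    using H_le_integer_term[OF assms] .
  have "exp (real j * t - G (real j)) = norm (c j) * exp t ^ j"
    by (simp add: norm_c exp_of_nat_mult[symmetric] flip: exp_add)
  also have "\<dots> \<le> max_modulus f (exp t)"
    by (rule Cauchy_le_max_modulus) simp
  finally have le: "exp (real j * t - G (real j)) \<le> max_modulus f (exp t)" .
  hence "real j * t - G (real j) \<le> ln (max_modulus f (exp t))"
    by (subst ln_ge_iff) (auto intro: less_le_trans[OF exp_gt_zero])
  with j show ?thesis
    by (simp add: phi_def log_max_modulus_def)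
qed

lemma phi_bounds:
  obtains B where "B \<ge> 1"
    "eventually (\<lambda>t. H t - B * t \<le> phi f t \<and> phi f t \<le> H t + B * t) at_top"
proof -
  obtain B where B: "B \<ge> 1" "eventually (\<lambda>t. h t \<le> exp (B * t)) at_top"
    by (rule h_exponential_bound)
  have "eventually (\<lambda>t. h (t + 1) \<le> exp (B * (t + 1))) at_top"
    by (rule eventually_compose_filterlim[OF B(2)]) real_asymp
  hence "eventually (\<lambda>t. H t - (3 * B) * t \<le> phi f t \<and> phi f t \<le> H t + (3 * B) * t) at_top"
    using eventually_h_pos eventually_ge_at_top[of 3]
  proof eventually_elim
    case (elim t)
    \<comment> \<open>For \<open>a \<ge> 1\<close> one has \<open>a + 3 \<le> 4 * a\<close>; the
      condition \<open>t \<ge> 3\<close> serves to make \<open>exp (B * t)\<close> at least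
      4.\<close>
    have "h (t + 1) + 3 \<le> exp (B * (t + 1)) * exp (B * t)"
    proof -
      have Bt: "3 \<le> B * t"
        using B(1) elim mult_mono[of 1 B 3 t] by simp
      hence "4 \<le> exp (B * t)"
        using exp_ge_add_one_self[of "B * t"] by linarith
      moreover have "1 \<le> exp (B * (t + 1))"
        using B(1) elim by (subst one_le_exp_iff) auto
      moreover have "exp (B * (t + 1)) * 4 \<le> exp (B * (t + 1)) * exp (B * t)"
        by (intro mult_left_mono \<open>4 \<le> exp (B * t)\<close>) simp
      ultimately have "exp (B * (t + 1)) + 3 \<le> exp (B * (t + 1)) * exp (B * t)"
        by linarith
      with elim show ?thesis by simp
    qed
    also have "\<dots> = exp (2 * B * t + B)"
      by (simp add: algebra_simps flip: exp_add)
    finally have le: "h (t + 1) + 3 \<le> exp (2 * B * t + B)" .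
    have h1: "0 \<le> h (t + 1)"
      using h_mono[of t "t + 1"] elim by simp
    have "ln (h (t + 1) + 3) \<le> 2 * B * t + B"
      using le h1 ln_mono[of "h (t + 1) + 3" "exp (2 * B * t + B)"] by simp
    moreover have "B \<le> B * t"
      using B(1) elim by simp
    ultimately have "phi f t \<le> H t + 3 * B * t"
      using phi_le[of t] elim by simp
    moreover have "t \<le> 3 * B * t"
      using B(1) elim by simp
    moreover have "H t - t \<le> phi f t"
      using phi_ge elim by simp
    ultimately show ?case
      by linarith
  qed
  thus ?thesis
    using that[of "3 * B"] B(1) by simp
qed

text \<open>Increments of \<open>H\<close> over unit intervals are controlled by \<open>h\<close>,
  and the linear error in \<open>phi\<close> is small against \<open>h\<close>. All later statements
  about increments and order rest on these bounds.\<close>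

lemma phi_increment_bounds:
  obtains K where "K \<ge> 1" "eventually (\<lambda>t. h t \<le> K * h (t - 1)) at_top"
    "eventually (\<lambda>t. phi f (t + 1) - phi f t \<le> 2 * h (t + 1)) at_top"
    "eventually (\<lambda>t. h (t - 1) / 2 \<le> phi f t - phi f (t - 1)) at_top"
    "eventually (\<lambda>t. h (t - 1) / 2 \<le> phi f t) at_top"
    "eventually (\<lambda>t. phi f t \<le> 2 * t * h t) at_top"
proof -
  obtain K where K: "K \<ge> 1" "eventually (\<lambda>t. h (t + 1) \<le> K * h t) at_top"
    by (rule eventually_doubling)
  obtain B where B: "B \<ge> 1"
    "eventually (\<lambda>t. H t - B * t \<le> phi f t \<and> phi f t \<le> H t + B * t) at_top"
    by (rule phi_bounds)
  \<comment> \<open>The two errors in the increment from \<open>t - 1\<close> to \<open>t\<close>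
    add up to \<open>2 * B * (t - 1) + B \<le> 3 * B * (t - 1)\<close>. The constant 8 keeps this
    below \<open>h (t - 1) / 2\<close>; the increment from \<open>t\<close> to \<open>t + 1\<close>
    is treated alike.\<close>
  have ev: "eventually (\<lambda>t. H t - B * t \<le> phi f t \<and> phi f t \<le> H t + B * t \<and>
      8 * B * t \<le> h t \<and> h (t + 1) \<le> K * h t \<and> t \<ge> 1) at_top"
    using K(2) B(2) eventually_h_ge[of "8 * B"] eventually_ge_at_top[of 1]
    by eventually_elim auto
  have ev': "eventually (\<lambda>t. H (t - 1) - B * (t - 1) \<le> phi f (t - 1) \<and>
      phi f (t - 1) \<le> H (t - 1) + B * (t - 1) \<and> 8 * B * (t - 1) \<le> h (t - 1) \<and>
      h (t - 1 + 1) \<le> K * h (t - 1) \<and> t - 1 \<ge> 1) at_top"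
    by (rule eventually_compose_filterlim[OF ev]) real_asymp
  have ev'': "eventually (\<lambda>t. H (t + 1) - B * (t + 1) \<le> phi f (t + 1) \<and>
      phi f (t + 1) \<le> H (t + 1) + B * (t + 1) \<and> 8 * B * (t + 1) \<le> h (t + 1) \<and>
      h (t + 1 + 1) \<le> K * h (t + 1) \<and> t + 1 \<ge> 1) at_top"
    by (rule eventually_compose_filterlim[OF ev]) real_asymp
  have le_B: "B \<le> B * t" if "t \<ge> 1" for t
    using mult_left_mono[OF that, of B] B(1) by simp
  have nonneg: "0 \<le> h t" if "8 * B * t \<le> h t" "t \<ge> 1" for t
    by (rule order_trans[OF _ that(1)]) (use that B(1) in simp)
  show ?thesis
  proof (rule that)
    show "eventually (\<lambda>t. h t \<le> K * h (t - 1)) at_top"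
      using ev' by eventually_elim auto
    show "eventually (\<lambda>t. phi f (t + 1) - phi f t \<le> 2 * h (t + 1)) at_top"
      using ev ev''
    proof eventually_elim
      case (elim t)
      have "H (t + 1) - H t \<le> h (t + 1)"
        using H_diff_ge[of "t + 1" t] nonneg[of t] nonneg[of "t + 1"] elim by simp
      moreover have "B \<le> B * t"
        using elim le_B by simp
      ultimately show ?case
        using elim B(1) by (simp only: algebra_simps mult_1_left mult_1_right) (elim conjE, linarith)
    qed
    show "eventually (\<lambda>t. h (t - 1) / 2 \<le> phi f t - phi f (t - 1)) at_top"
      using ev ev'
    proof eventually_elim
      case (elim t)
      have "h (t - 1) \<le> H t - H (t - 1)"
        using H_diff_ge[of "t - 1" t] nonneg[of t] nonneg[of "t - 1"] elim by simp
      moreover have "B \<le> B * (t - 1)"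
        using elim le_B by simp
      ultimately show ?case
        using elim B(1) by (simp only: algebra_simps mult_1_left mult_1_right) (elim conjE, linarith)
    qed
    show "eventually (\<lambda>t. h (t - 1) / 2 \<le> phi f t) at_top"
      using ev ev'
    proof eventually_elim
      case (elim t)
      have "h (t - 1) \<le> H t - H (t - 1)"
        using H_diff_ge[of "t - 1" t] nonneg[of t] nonneg[of "t - 1"] elim by simp
      moreover have "0 \<le> H (t - 1)"
        using H_nonneg[of "t - 1"] nonneg[of "t - 1"] elim by simp
      moreover have "B \<le> B * (t - 1)"
        using elim le_B by simp
      ultimately show ?case
        using elim B(1) by (simp only: algebra_simps mult_1_left mult_1_right) (elim conjE, linarith)
    qed
    show "eventually (\<lambda>t. phi f t \<le> 2 * t * h t) at_top"
      using ev
    proof eventually_elim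
      case (elim t)
      have "B \<le> B * t"
        using elim le_B by simp
      hence "B \<le> h t"
        using elim B(1) by linarith
      hence "B * t \<le> t * h t"
        using elim by (simp add: mult.commute)
      moreover have "H t \<le> t * h t"
        using H_le nonneg elim by simp
      moreover have "phi f t \<le> H t + B * t"
        using elim by simp
      ultimately show ?case
        by linarith
    qed
  qed (rule K(1))
qed

section \<open>Superquadratic growth, class and order\<close>

lemma phi_superquadratic: "filterlim (\<lambda>t. phi f t / t\<^sup>2) at_top at_top"
  unfolding filterlim_at_top
proof
  fix Z :: real
  obtain B where B: "B \<ge> 1"
    "eventually (\<lambda>t. H t - B * t \<le> phi f t \<and> phi f t \<le> H t + B * t) at_top"
    by (rule phi_bounds)
  \<comment> \<open>The increment of \<open>H\<close> from \<open>t / 2\<close> to \<open>t\<close>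
    is at least \<open>h (t / 2) * (t / 2)\<close>, so the factor 4 turns
    \<open>(t / 2)\<^sup>2\<close> into \<open>t\<^sup>2\<close>. The summand \<open>B\<close> pays
    for the error \<open>B * t \<le> B * t\<^sup>2\<close>.\<close>
  have "eventually (\<lambda>t. 4 * (Z + B) * (t / 2) \<le> h (t / 2)) at_top"
    by (rule eventually_compose_filterlim[OF eventually_h_ge]) real_asymp
  moreover have "eventually (\<lambda>t. 0 < h (t / 2)) at_top"
    by (rule eventually_compose_filterlim[OF eventually_h_pos]) real_asymp
  ultimately show "eventually (\<lambda>t. Z \<le> phi f t / t\<^sup>2) at_top"
    using B(2) eventually_h_pos eventually_ge_at_top[of 1]
  proof eventually_elim
    case (elim t)
    have "4 * (Z + B) * (t / 2) * (t / 2) \<le> h (t / 2) * (t / 2)"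
      using elim by (intro mult_right_mono) auto
    also have "\<dots> \<le> H t - H (t / 2)"
      using H_diff_ge[of "t / 2" t] elim by simp
    also have "\<dots> \<le> H t"
      using H_nonneg[of "t / 2"] elim by simp
    finally have "(Z + B) * t\<^sup>2 \<le> H t"
      by (simp add: power2_eq_square algebra_simps)
    moreover have "B * t \<le> B * t\<^sup>2"
      using elim B(1) by (simp add: power2_eq_square)
    ultimately have "Z * t\<^sup>2 \<le> phi f t"
      using elim by (simp add: algebra_simps)
    thus ?case
      using elim by (simp add: field_simps)
  qed
qed

text \<open>Two unit steps give \<open>h (t + 1) \<le> K\<^sup>2 * h (t - 1)\<close>. The factors 2
  in the numerator and 1/2 in the denominator then lead to \<open>4 * K\<^sup>2\<close>.\<close>

lemma phi_increment_ratio_bounded: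
  "Limsup at_top (\<lambda>t. ereal ((phi f (t + 1) - phi f t) / (phi f t - phi f (t - 1)))) < \<infinity>"
proof -
  obtain K where K: "K \<ge> 1" "eventually (\<lambda>t. h t \<le> K * h (t - 1)) at_top"
    "eventually (\<lambda>t. phi f (t + 1) - phi f t \<le> 2 * h (t + 1)) at_top"
    "eventually (\<lambda>t. h (t - 1) / 2 \<le> phi f t - phi f (t - 1)) at_top"
    by (rule phi_increment_bounds)
  have K': "eventually (\<lambda>t. h (t + 1) \<le> K * h (t + 1 - 1)) at_top"
    by (rule eventually_compose_filterlim[OF K(2)]) real_asymp
  have pos: "eventually (\<lambda>t. 0 < h (t - 1)) at_top"
    by (rule eventually_compose_filterlim[OF eventually_h_pos]) real_asymp
  have "eventually (\<lambda>t. (phi f (t + 1) - phi f t) / (phi f t - phi f (t - 1)) \<le> 4 * K\<^sup>2) at_top"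
    using K(2-4) K' pos
  proof eventually_elim
    case (elim t)
    have "h (t + 1) \<le> K * (K * h (t - 1))"
      using elim K(1) by (auto intro: order_trans[OF _ mult_left_mono])
    hence "phi f (t + 1) - phi f t \<le> 4 * K\<^sup>2 * (h (t - 1) / 2)"
      using elim by (simp add: power2_eq_square)
    also have "\<dots> \<le> 4 * K\<^sup>2 * (phi f t - phi f (t - 1))"
      using elim by (intro mult_left_mono) auto
    finally show ?case
      using elim by (subst pos_divide_le_eq) auto
  qed
  hence "Limsup at_top (\<lambda>t. ereal ((phi f (t + 1) - phi f t) / (phi f t - phi f (t - 1))))
      \<le> ereal (4 * K\<^sup>2)"
    by (intro Limsup_bounded) simp
  thus ?thesis
    by (rule order_le_less_trans) simp
qed

text \<open>Since \<open>h t / (2 * K) \<le> phi f t \<le> 2 * t * h t\<close> eventually, the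
  logarithms of \<open>phi f t\<close> and \<open>h t\<close> differ by O(ln t), which disappears
  after division by \<open>t\<close>.\<close>

lemma growth_order_eq: "growth_order f = Limsup at_top (\<lambda>t. ereal (ln (h t) / t))"
  unfolding growth_order_eq_Limsup_phi
proof (rule Limsup_ereal_eq_of_diff_tendsto_0)
  obtain K where K: "K \<ge> 1" "eventually (\<lambda>t. h t \<le> K * h (t - 1)) at_top"
    "eventually (\<lambda>t. h (t - 1) / 2 \<le> phi f t) at_top"
    "eventually (\<lambda>t. phi f t \<le> 2 * t * h t) at_top"
    by (rule phi_increment_bounds)
  have ev: "eventually (\<lambda>t. - ln (2 * K) / t \<le> ln (phi f t) / t - ln (h t) / t \<and>
      ln (phi f t) / t - ln (h t) / t \<le> ln (2 * t) / t) at_top"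
    using K(2-4) eventually_h_pos eventually_gt_at_top[of 0]
  proof eventually_elim
    case (elim t)
    have "K * h (t - 1) \<le> K * (2 * phi f t)"
      using elim K(1) by (intro mult_left_mono) auto
    with elim have "h t \<le> K * (2 * phi f t)"
      by linarith
    hence le: "h t / (2 * K) \<le> phi f t"
      using K(1) by (simp add: field_simps)
    have pos: "0 < h t / (2 * K)"
      using elim K(1) by simp
    have "ln (h t / (2 * K)) \<le> ln (phi f t)"
      using le pos by simp
    moreover have "ln (h t / (2 * K)) = ln (h t) - ln (2 * K)"
      using elim K(1) by (simp add: ln_div)
    moreover have "ln (phi f t) \<le> ln (2 * t * h t)"
      using elim le pos by simp
    moreover have "ln (2 * t * h t) = ln (2 * t) + ln (h t)"
      using elim by (simp add: ln_mult)
    ultimately have "- ln (2 * K) \<le> ln (phi f t) - ln (h t)" "ln (phi f t) - ln (h t) \<le> ln (2 * t)"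
      by simp_all
    thus ?case
      unfolding diff_divide_distrib[symmetric]
      using elim by (intro conjI divide_right_mono) auto
  qed
  show "((\<lambda>t. ln (phi f t) / t - ln (h t) / t) \<longlongrightarrow> 0) at_top"
  proof (rule tendsto_sandwich)
    show "((\<lambda>t. - ln (2 * K) / t) \<longlongrightarrow> 0) at_top"
      by real_asymp
    show "((\<lambda>t::real. ln (2 * t) / t) \<longlongrightarrow> 0) at_top"
      by real_asymp
  qed (use ev in \<open>auto elim: eventually_mono\<close>)
qed

lemma finite_order: "finite_order f"
proof -
  obtain B where "eventually (\<lambda>t. h t \<le> exp (B * t)) at_top"
    by (rule h_exponential_bound)
  hence "eventually (\<lambda>t. ereal (ln (h t) / t) \<le> ereal B) at_top"
    using eventually_h_pos eventually_gt_at_top[of 0]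
  proof eventually_elim
    case (elim t)
    hence "ln (h t) \<le> B * t"
      using ln_mono[of "h t" "exp (B * t)"] by simp
    with elim show ?case
      by (simp add: field_simps)
  qed
  hence "growth_order f \<le> ereal B"
    unfolding growth_order_eq by (rule Limsup_bounded)
  thus ?thesis
    unfolding finite_order_def by (rule order_le_less_trans) simp
qed

lemma coeff_nonzero: "c j \<noteq> 0"
  using norm_c[of j] by auto

lemma in_class_C: "f \<in> class_C"
  using finite_order phi_increment_ratio_bounded holomorphic not_polynomial[OF coeff_nonzero]
  by (simp add: class_C_def class_C_I_def entire_def)

end

theorem theorem1p17:
  fixes h :: "real \<Rightarrow> real" and c :: "nat \<Rightarrow> complex"
    and f :: "complex \<Rightarrow> complex" and U :: "complex set"
  assumes "continuous_on {0..} h"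
    and "strict_mono_on {0..} h"
    and "h 0 \<le> 0"
    and "filterlim (\<lambda>t. h t / t) at_top at_top"
    and "Limsup at_top (\<lambda>t. ereal (h (t + 1) / h t)) < \<infinity>"
    and "f = (\<lambda>z. \<Sum>j. c j * z ^ j)"
    and "open U" and "0 \<in> U"
    and "\<And>z. z \<in> U \<Longrightarrow> summable (\<lambda>j. c j * z ^ j)"
    and "f holomorphic_on U"
    and "\<And>j. c j \<noteq> 0"
    and "\<And>j. ln (norm (c j)) = - integral {0..real j} (inv_into {0..} h)"
  shows "(\<forall>z. (\<lambda>j. c j * z ^ j) sums f z) \<and> entire f \<and> finite_order f \<and> f \<in> class_C \<and>
    filterlim (\<lambda>t. phi f t / t\<^sup>2) at_top at_top \<and>
    growth_order f = Limsup at_top (\<lambda>t. ereal (ln (h t) / t))"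
proof -
  interpret growth_profile h
    using assms by unfold_locales
  interpret growth_series h c f
  proof
    \<comment> \<open>\<open>exp\<close> undoes \<open>ln\<close> only at positive arguments; the
      nonvanishing of \<open>c j\<close> supplies this.\<close>
    show "norm (c j) = exp (- G (real j))" for j
      using assms(11)[of j] assms(12)[of j] exp_ln[of "norm (c j)"] by (simp add: G_def g_def)
  qed (simp add: assms(6))
  show ?thesis
    using sums finite_order in_class_C phi_superquadratic growth_order_eq holomorphic
    by (auto simp: entire_def)
qed

end
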